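(* Let $n\ge 1$ and $m\ge 2$ be integers. Assume that there exists a symmetric $5$-class association scheme on $4n^2(m+1)$ vertices whose adjacency matrices $A_0,\dots,A_5$ and primitive idempotents $E_0,\dots,E_5$ can be ordered so that its first and second eigenmatrices (rows and columns indexed by $0,\dots,5$) are $$P=\begin{pmatrix} 1&2n-1&2n(2n-1)&2nm&n(2n-1)m&n(2n-1)m\\ 1&-1&0&0&nm&-nm\\ 1&2n-1&-2n&2nm&-nm&-nm\\ 1&2n-1&-2n&-2n&n&n\\ 1&-1&0&0&-n&n\\ 1&2n-1&2n(2n-1)&-2n&-n(2n-1)&-n(2n-1) \end{pmatrix}$$ and $$Q=\begin{pmatrix} 1&2n(2n-1)&2n-1&(2n-1)m&2n(2n-1)m&m\\ 1&-2n&2n-1&(2n-1)m&-2nm&m\\ 1&0&-1&-m&0&m\\ 1&0&2n-1&-2n+1&0&-1\\ 1&2n&-1&1&-2n&-1\\ 1&-2n&-1&1&2n&-1 \end{pmatrix}.$$ Then there exists a set $\{H_1,\dots,H_m\}$ of $m$ mutually unbiased Bush-type Hadamard matrices of order $4n^2$.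
   Context: $I_k$ and $J_k$ denote the identity matrix and the all-ones matrix of order $k$. A symmetric $d$-class association scheme on a vertex set of size $N$ is a set of nonzero symmetric $(0,1)$-matrices $A_0,\dots,A_d$ of order $N$ (the adjacency matrices) such that (1) $A_0=I_N$; (2) $\sum_{i=0}^d A_i=J_N$; (3) for all $i,j$, $A_iA_j=\sum_{k=0}^d p_{ij}^kA_k$ for some numbers $p_{ij}^k$. The span of the $A_i$ is a commutative algebra, with a basis of primitive idempotents $E_0=\frac1N J_N,E_1,\dots,E_d$. The first eigenmatrix $P=(P_{ij})$ and second eigenmatrix $Q=(Q_{ij})$ are defined by $A_j=\sum_{i=0}^d P_{ij}E_i$ and $E_j=\frac1N\sum_{i=0}^d Q_{ij}A_i$. A Hadamard matrix of order $k$ is a $k\times k$ matrix with entries in $\{-1,1\}$ and pairwise orthogonal rows. Two Hadamard matrices $H,K$ of order $k$ are unbiased if $HK^t=\sqrt{k}\,L$ for some Hadamard matrix $L$; a set of Hadamard matrices is mutually unbiased if any two distinct members are unbiased. A Bush-type Hadamard matrix of order $4n^2$ is a Hadamard matrix $H=[H_{ij}]_{1\le i,j\le 2n}$ of order $4n^2$, partitioned into $2n\times 2n$ blocks $H_{ij}$, such that $H_{ii}=J_{2n}$ for all $i$ and $H_{ij}J_{2n}=J_{2n}H_{ij}=0$ for all $i\neq j$. *)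

theory Defs
  imports Complex_Main "Jordan_Normal_Form.Matrix"
begin

definition all_ones_mat :: "nat \<Rightarrow> real mat" where
  "all_ones_mat k = mat k k (\<lambda>_. 1)"

text \<open>The linear combination of the matrices \<open>B 0, \<dots>, B d\<close> of order \<open>N\<close> with coefficients
  \<open>c 0, \<dots>, c d\<close>. It is written entrywise since type \<^typ>\<open>'a mat\<close> does not
  fix the dimensions and so is no instance of \<^class>\<open>comm_monoid_add\<close>.\<close>

definition mat_lincomb :: "nat \<Rightarrow> nat \<Rightarrow> (nat \<Rightarrow> real) \<Rightarrow> (nat \<Rightarrow> real mat) \<Rightarrow> real mat" where
  "mat_lincomb N d c B = mat N N (\<lambda>(x, y). \<Sum>i\<le>d. c i * B i $$ (x, y))"

definition symmetric_assoc_scheme :: "nat \<Rightarrow> nat \<Rightarrow> (nat \<Rightarrow> real mat) \<Rightarrow> bool" where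
  "symmetric_assoc_scheme N d A \<longleftrightarrow>
     (\<forall>i\<le>d. A i \<in> carrier_mat N N \<and> A i \<noteq> 0\<^sub>m N N \<and>
            transpose_mat (A i) = A i \<and> elements_mat (A i) \<subseteq> {0, 1}) \<and>
     A 0 = 1\<^sub>m N \<and>
     mat_lincomb N d (\<lambda>_. 1) A = all_ones_mat N \<and>
     (\<exists>p :: nat \<Rightarrow> nat \<Rightarrow> nat \<Rightarrow> real.
        \<forall>i\<le>d. \<forall>j\<le>d. A i * A j = mat_lincomb N d (p i j) A)"

definition adjacency_algebra :: "nat \<Rightarrow> nat \<Rightarrow> (nat \<Rightarrow> real mat) \<Rightarrow> real mat set" where
  "adjacency_algebra N d A = range (\<lambda>c. mat_lincomb N d c A)"

definition primitive_idempotent :: "nat \<Rightarrow> real mat set \<Rightarrow> real mat \<Rightarrow> bool" where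
  "primitive_idempotent N \<A> E \<longleftrightarrow>
     E \<in> \<A> \<and> E * E = E \<and> E \<noteq> 0\<^sub>m N N \<and>
     (\<forall>F\<in>\<A>. \<forall>G\<in>\<A>.
        F * F = F \<and> G * G = G \<and> F * G = 0\<^sub>m N N \<and> G * F = 0\<^sub>m N N \<and> E = F + G \<longrightarrow>
        F = 0\<^sub>m N N \<or> G = 0\<^sub>m N N)"

text \<open>The primitive idempotents of the adjacency algebra form a basis of it, so the basis
  \<open>E 0, \<dots>, E d\<close> is an enumeration of all of them without repetition.\<close>

definition scheme_idempotents :: "nat \<Rightarrow> nat \<Rightarrow> (nat \<Rightarrow> real mat) \<Rightarrow> (nat \<Rightarrow> real mat) \<Rightarrow> bool" where
  "scheme_idempotents N d A E \<longleftrightarrow>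
     E 0 = (1 / real N) \<cdot>\<^sub>m all_ones_mat N \<and>
     bij_betw E {..d} {F. primitive_idempotent N (adjacency_algebra N d A) F}"

definition is_first_eigenmatrix ::
    "nat \<Rightarrow> nat \<Rightarrow> (nat \<Rightarrow> real mat) \<Rightarrow> (nat \<Rightarrow> real mat) \<Rightarrow> real mat \<Rightarrow> bool" where
  "is_first_eigenmatrix N d A E P \<longleftrightarrow>
     P \<in> carrier_mat (d + 1) (d + 1) \<and>
     (\<forall>j\<le>d. A j = mat_lincomb N d (\<lambda>i. P $$ (i, j)) E)"

definition is_second_eigenmatrix ::
    "nat \<Rightarrow> nat \<Rightarrow> (nat \<Rightarrow> real mat) \<Rightarrow> (nat \<Rightarrow> real mat) \<Rightarrow> real mat \<Rightarrow> bool" where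
  "is_second_eigenmatrix N d A E Q \<longleftrightarrow>
     Q \<in> carrier_mat (d + 1) (d + 1) \<and>
     (\<forall>j\<le>d. E j = (1 / real N) \<cdot>\<^sub>m mat_lincomb N d (\<lambda>i. Q $$ (i, j)) A)"

definition bush_P :: "real \<Rightarrow> real \<Rightarrow> real mat" where
  "bush_P n m = mat_of_rows_list 6
    [[1, 2*n - 1, 2*n*(2*n - 1), 2*n*m, n*(2*n - 1)*m, n*(2*n - 1)*m],
     [1, -1,      0,             0,     n*m,           -(n*m)],
     [1, 2*n - 1, -(2*n),        2*n*m, -(n*m),        -(n*m)],
     [1, 2*n - 1, -(2*n),        -(2*n), n,            n],
     [1, -1,      0,             0,     -n,            n],
     [1, 2*n - 1, 2*n*(2*n - 1), -(2*n), -(n*(2*n - 1)), -(n*(2*n - 1))]]"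

definition bush_Q :: "real \<Rightarrow> real \<Rightarrow> real mat" where
  "bush_Q n m = mat_of_rows_list 6
    [[1, 2*n*(2*n - 1), 2*n - 1, (2*n - 1)*m, 2*n*(2*n - 1)*m, m],
     [1, -(2*n),        2*n - 1, (2*n - 1)*m, -(2*n*m),        m],
     [1, 0,             -1,      -m,          0,               m],
     [1, 0,             2*n - 1, -(2*n) + 1,  0,               -1],
     [1, 2*n,           -1,      1,           -(2*n),          -1],
     [1, -(2*n),        -1,      1,           2*n,             -1]]"

definition hadamard_mat :: "nat \<Rightarrow> real mat \<Rightarrow> bool" where
  "hadamard_mat k H \<longleftrightarrow>
     H \<in> carrier_mat k k \<and> elements_mat H \<subseteq> {-1, 1} \<and>
     (\<forall>i<k. \<forall>j<k. i \<noteq> j \<longrightarrow> row H i \<bullet> row H j = 0)"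

definition unbiased :: "nat \<Rightarrow> real mat \<Rightarrow> real mat \<Rightarrow> bool" where
  "unbiased k H K \<longleftrightarrow>
     (\<exists>L. hadamard_mat k L \<and> H * transpose_mat K = sqrt (real k) \<cdot>\<^sub>m L)"

definition mutually_unbiased :: "nat \<Rightarrow> real mat set \<Rightarrow> bool" where
  "mutually_unbiased k S \<longleftrightarrow>
     (\<forall>H\<in>S. hadamard_mat k H) \<and> (\<forall>H\<in>S. \<forall>K\<in>S. H \<noteq> K \<longrightarrow> unbiased k H K)"

text \<open>Blocks are indexed from 0.\<close>

definition mat_block :: "nat \<Rightarrow> real mat \<Rightarrow> nat \<Rightarrow> nat \<Rightarrow> real mat" where
  "mat_block b H i j = mat b b (\<lambda>(x, y). H $$ (b * i + x, b * j + y))"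

definition bush_type_hadamard :: "nat \<Rightarrow> real mat \<Rightarrow> bool" where
  "bush_type_hadamard n H \<longleftrightarrow>
     hadamard_mat (4 * n\<^sup>2) H \<and>
     (\<forall>i<2*n. mat_block (2*n) H i i = all_ones_mat (2*n)) \<and>
     (\<forall>i<2*n. \<forall>j<2*n. i \<noteq> j \<longrightarrow>
        mat_block (2*n) H i j * all_ones_mat (2*n) = 0\<^sub>m (2*n) (2*n) \<and>
        all_ones_mat (2*n) * mat_block (2*n) H i j = 0\<^sub>m (2*n) (2*n))"

end

(* The five relations sort the vertices by two transversal equivalence relations: B = A_0 + A_1 + A_2
   with m + 1 classes of size 4n^2, and R = A_0 + A_1 + A_3 with 2n classes, each R-class meeting each
   B-class in 2n points (all of this is read off the eigenvalues: B^2 = 4n^2 B, R^2 = 2n(m+1) R,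
   R B = 2n J). The matrix G = 2n I + A_3 + A_4 - A_5 satisfies G^2 = 2n(m+1) G, so it is a multiple
   of a projection of rank 4n^2, which is the order of its diagonal blocks 2n I on the B-classes.
   Hence the blocks satisfy G_ab G_bc = 2n G_ac for all a, b, c. Consequently the G_a0 with a \<noteq> 0,
   written with respect to the grid of R-classes, are Hadamard and satisfy
   G_a0 (G_b0)^t = 2n G_ab; they are of Bush type because A_3 is constant 1 on R-classes, while
   (A_4 - A_5)(A_0 + A_1) = 0. *)

theory Submission
  imports Defs
begin

section \<open>Entrywise calculus of linear combinations of matrices\<close>

lemma mat_lincomb_carrier [simp]: "mat_lincomb N d c B \<in> carrier_mat N N"
  by (simp add: mat_lincomb_def)

lemma mat_lincomb_dim [simp]:
  "dim_row (mat_lincomb N d c B) = N" "dim_col (mat_lincomb N d c B) = N"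
  by (simp_all add: mat_lincomb_def)

lemma mat_lincomb_index [simp]:
  "x < N \<Longrightarrow> y < N \<Longrightarrow> mat_lincomb N d c B $$ (x, y) = (\<Sum>i\<le>d. c i * B i $$ (x, y))"
  by (simp add: mat_lincomb_def)

lemma times_mat_index_sum:
  assumes "A \<in> carrier_mat N N" "B \<in> carrier_mat N N" "x < N" "y < N"
  shows "(A * B) $$ (x, y) = (\<Sum>z<N. A $$ (x, z) * B $$ (z, y))"
  using assms by (auto simp: scalar_prod_def lessThan_atLeast0 intro!: sum.cong)

text \<open>Bilinearity of the product, for two arbitrary families because it serves both the
  adjacency matrices and the primitive idempotents.\<close>

lemma mat_lincomb_times_index:
  assumes A: "\<And>i. i \<le> d \<Longrightarrow> A i \<in> carrier_mat N N"
    and B: "\<And>i. i \<le> d \<Longrightarrow> B i \<in> carrier_mat N N"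
    and xy: "x < N" "y < N"
  shows "(mat_lincomb N d c A * mat_lincomb N d c' B) $$ (x, y) =
    (\<Sum>i\<le>d. \<Sum>j\<le>d. c i * c' j * (A i * B j) $$ (x, y))"
proof -
  have "(mat_lincomb N d c A * mat_lincomb N d c' B) $$ (x, y) =
    (\<Sum>z<N. (\<Sum>i\<le>d. c i * A i $$ (x, z)) * (\<Sum>j\<le>d. c' j * B j $$ (z, y)))"
    using xy by (subst times_mat_index_sum[where N = N]) auto
  also have "\<dots> = (\<Sum>z<N. \<Sum>i\<le>d. \<Sum>j\<le>d. c i * c' j * (A i $$ (x, z) * B j $$ (z, y)))"
    by (simp add: sum_product mult_ac)
  also have "\<dots> = (\<Sum>i\<le>d. \<Sum>z<N. \<Sum>j\<le>d. c i * c' j * (A i $$ (x, z) * B j $$ (z, y)))"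
    by (rule sum.swap)
  also have "\<dots> = (\<Sum>i\<le>d. \<Sum>j\<le>d. \<Sum>z<N. c i * c' j * (A i $$ (x, z) * B j $$ (z, y)))"
    by (intro sum.cong sum.swap refl)
  also have "\<dots> = (\<Sum>i\<le>d. \<Sum>j\<le>d. c i * c' j * (A i * B j) $$ (x, y))"
    using A B xy
    by (intro sum.cong refl) (simp add: sum_distrib_left times_mat_index_sum[where N = N])
  finally show ?thesis .
qed

section \<open>Adjacency algebra, orthogonality of primitive idempotents, and products computed on
  eigenvalues\<close>

context
  fixes N d :: nat and A :: "nat \<Rightarrow> real mat"
  assumes scheme: "symmetric_assoc_scheme N d A"
begin

lemma scheme_carrier: "i \<le> d \<Longrightarrow> A i \<in> carrier_mat N N"
  using scheme by (simp add: symmetric_assoc_scheme_def)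

lemma scheme_sym:
  assumes "i \<le> d" "x < N" "y < N"
  shows "A i $$ (x, y) = A i $$ (y, x)"
proof -
  have "transpose_mat (A i) = A i" "A i \<in> carrier_mat N N"
    using scheme assms by (auto simp: symmetric_assoc_scheme_def)
  then show ?thesis
    using assms by (metis carrier_matD index_transpose_mat(1))
qed

lemma scheme_entry:
  assumes "i \<le> d" "x < N" "y < N"
  shows "A i $$ (x, y) \<in> {0, 1}"
proof -
  have "elements_mat (A i) \<subseteq> {0, 1}" "A i \<in> carrier_mat N N"
    using scheme assms by (auto simp: symmetric_assoc_scheme_def)
  then show ?thesis
    using assms unfolding elements_mat_def by fastforce
qed

lemma scheme_sum_entries:
  assumes "x < N" "y < N"
  shows "(\<Sum>i\<le>d. A i $$ (x, y)) = 1"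
proof -
  have "mat_lincomb N d (\<lambda>_. 1) A $$ (x, y) = all_ones_mat N $$ (x, y)"
    using scheme by (simp add: symmetric_assoc_scheme_def)
  then show ?thesis using assms by (simp add: all_ones_mat_def)
qed

lemma adjacency_algebra_carrier:
  "F \<in> adjacency_algebra N d A \<Longrightarrow> F \<in> carrier_mat N N"
  by (auto simp: adjacency_algebra_def)

lemma adjacency_algebra_times:
  assumes "F \<in> adjacency_algebra N d A" "G \<in> adjacency_algebra N d A"
  shows "F * G \<in> adjacency_algebra N d A"
proof -
  obtain c c' where F: "F = mat_lincomb N d c A" and G: "G = mat_lincomb N d c' A"
    using assms by (auto simp: adjacency_algebra_def)
  obtain p where p: "\<And>i j. i \<le> d \<Longrightarrow> j \<le> d \<Longrightarrow> A i * A j = mat_lincomb N d (p i j) A"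
    using scheme unfolding symmetric_assoc_scheme_def by blast
  have "F * G = mat_lincomb N d (\<lambda>k. \<Sum>i\<le>d. \<Sum>j\<le>d. c i * c' j * p i j k) A"
  proof (rule eq_matI)
    fix x y
    assume "x < dim_row (mat_lincomb N d (\<lambda>k. \<Sum>i\<le>d. \<Sum>j\<le>d. c i * c' j * p i j k) A)"
      "y < dim_col (mat_lincomb N d (\<lambda>k. \<Sum>i\<le>d. \<Sum>j\<le>d. c i * c' j * p i j k) A)"
    then have xy: "x < N" "y < N" by simp_all
    have "(F * G) $$ (x, y) = (\<Sum>i\<le>d. \<Sum>j\<le>d. c i * c' j * (A i * A j) $$ (x, y))"
      unfolding F G by (rule mat_lincomb_times_index[OF scheme_carrier scheme_carrier xy])
    also have "\<dots> = (\<Sum>i\<le>d. \<Sum>j\<le>d. \<Sum>k\<le>d. c i * c' j * p i j k * A k $$ (x, y))"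
      using xy by (intro sum.cong refl) (simp add: p sum_distrib_left mult_ac)
    also have "\<dots> = (\<Sum>i\<le>d. \<Sum>k\<le>d. \<Sum>j\<le>d. c i * c' j * p i j k * A k $$ (x, y))"
      by (intro sum.cong sum.swap refl)
    also have "\<dots> = (\<Sum>k\<le>d. \<Sum>i\<le>d. \<Sum>j\<le>d. c i * c' j * p i j k * A k $$ (x, y))"
      by (rule sum.swap)
    finally show "(F * G) $$ (x, y) =
        mat_lincomb N d (\<lambda>k. \<Sum>i\<le>d. \<Sum>j\<le>d. c i * c' j * p i j k) A $$ (x, y)"
      using xy by (simp add: sum_distrib_right)
  qed (simp_all add: F G)
  then show ?thesis by (auto simp: adjacency_algebra_def)
qed

lemma adjacency_algebra_minus:
  assumes "F \<in> adjacency_algebra N d A" "G \<in> adjacency_algebra N d A"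
  shows "F - G \<in> adjacency_algebra N d A"
proof -
  obtain c c' where "F = mat_lincomb N d c A" "G = mat_lincomb N d c' A"
    using assms by (auto simp: adjacency_algebra_def)
  then have "F - G = mat_lincomb N d (\<lambda>i. c i - c' i) A"
    by (intro eq_matI) (simp_all add: left_diff_distrib sum_subtractf)
  then show ?thesis by (auto simp: adjacency_algebra_def)
qed

lemma adjacency_algebra_transpose:
  assumes "F \<in> adjacency_algebra N d A"
  shows "transpose_mat F = F"
proof -
  obtain c where "F = mat_lincomb N d c A"
    using assms by (auto simp: adjacency_algebra_def)
  then show ?thesis
    by (intro eq_matI) (auto simp: scheme_sym intro!: sum.cong)
qed

text \<open>The algebra is closed under products and consists of symmetric matrices, while
  transposition reverses a product.\<close>

lemma adjacency_algebra_commute: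
  assumes "F \<in> adjacency_algebra N d A" "G \<in> adjacency_algebra N d A"
  shows "F * G = G * F"
proof -
  have "F * G = transpose_mat (F * G)"
    using assms by (simp add: adjacency_algebra_times adjacency_algebra_transpose)
  also have "\<dots> = transpose_mat G * transpose_mat F"
    by (rule transpose_mult[OF assms[THEN adjacency_algebra_carrier]])
  finally show ?thesis
    using assms by (simp add: adjacency_algebra_transpose)
qed

text \<open>By commutativity, \<open>K = E * F\<close> and \<open>L = E - K\<close> are orthogonal
  idempotents of the algebra with sum \<open>E\<close>, so primitivity of \<open>E\<close> forces
  one of them to vanish.\<close>

lemma primitive_idempotent_times:
  assumes E: "primitive_idempotent N (adjacency_algebra N d A) E"
    and F: "F \<in> adjacency_algebra N d A" "F * F = F"
  shows "E * F = 0\<^sub>m N N \<or> E * F = E"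
proof -
  have EA: "E \<in> adjacency_algebra N d A" and EE: "E * E = E"
    using E by (auto simp: primitive_idempotent_def)
  note carrier = adjacency_algebra_carrier[OF EA] adjacency_algebra_carrier[OF F(1)]
  define K where "K = E * F"
  have KA: "K \<in> adjacency_algebra N d A"
    unfolding K_def by (intro adjacency_algebra_times EA F)
  note carrier = carrier adjacency_algebra_carrier[OF KA]
  have EK: "E * K = K"
    unfolding K_def using carrier EE by (metis assoc_mult_mat)
  have KF: "K * F = K"
    unfolding K_def using carrier F by (metis assoc_mult_mat)
  have KE: "K * E = K"
    using EK adjacency_algebra_commute[OF EA KA] by simp
  have KK: "K * K = K"
    using assoc_mult_mat[OF carrier(3,1,2)] KE KF by (simp add: K_def)
  define L where "L = E - K"
  have LA: "L \<in> adjacency_algebra N d A"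
    unfolding L_def by (intro adjacency_algebra_minus EA KA)
  have KL: "K * L = 0\<^sub>m N N"
    using carrier by (simp add: L_def mult_minus_distrib_mat[of _ N N _ N] KE KK)
  have LK: "L * K = 0\<^sub>m N N"
    using carrier by (simp add: L_def minus_mult_distrib_mat[of _ N N _ _ N] EK KK)
  have EL: "E * L = L"
    using carrier by (simp add: L_def mult_minus_distrib_mat[of _ N N _ N] EE EK)
  have "L * L = E * L - K * L"
    using minus_mult_distrib_mat[OF carrier(1,3) LA[THEN adjacency_algebra_carrier]]
    by (simp add: L_def)
  then have "L * L = L"
    using LA[THEN adjacency_algebra_carrier] by (auto simp: EL KL)
  moreover have "E = K + L"
    using carrier by (auto simp: L_def)
  ultimately have "K = 0\<^sub>m N N \<or> L = 0\<^sub>m N N"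
    using E KA LA KK KL LK by (auto simp: primitive_idempotent_def)
  moreover have "K = E" if "L = 0\<^sub>m N N"
    using \<open>E = K + L\<close> that carrier by simp
  ultimately show ?thesis
    by (auto simp: K_def)
qed

text \<open>If the product were nonzero, primitivity of each factor would give both
  \<open>E * F = E\<close> and \<open>F * E = F\<close>, and commutativity would identify the
  two.\<close>

lemma primitive_idempotents_orthogonal:
  assumes E: "primitive_idempotent N (adjacency_algebra N d A) E"
    and F: "primitive_idempotent N (adjacency_algebra N d A) F" and "E \<noteq> F"
  shows "E * F = 0\<^sub>m N N"
proof -
  have "E \<in> adjacency_algebra N d A" "F \<in> adjacency_algebra N d A" "E * E = E" "F * F = F"
    using E F by (auto simp: primitive_idempotent_def)
  then show ?thesis
    using primitive_idempotent_times[OF E] primitive_idempotent_times[OF F]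
      adjacency_algebra_commute \<open>E \<noteq> F\<close> by metis
qed

text \<open>Row \<open>i\<close> of \<open>P\<close> lists the eigenvalues of the adjacency matrices
  on \<open>E i\<close>. Since the \<open>E i\<close> are orthogonal idempotents, multiplying two
  combinations means multiplying their eigenvalues for each \<open>i\<close>, so a matrix identity
  reduces to \<open>d + 1\<close> scalar ones.\<close>

lemma mat_lincomb_times_eigenvalues:
  assumes E: "scheme_idempotents N d A E" and P: "is_first_eigenmatrix N d A E P"
    and ev: "\<And>i. i \<le> d \<Longrightarrow>
      (\<Sum>j\<le>d. c j * P $$ (i, j)) * (\<Sum>j\<le>d. c' j * P $$ (i, j)) = (\<Sum>j\<le>d. c'' j * P $$ (i, j))"
    and xy: "x < N" "y < N"
  shows "(\<Sum>z<N. (\<Sum>i\<le>d. c i * A i $$ (x, z)) * (\<Sum>i\<le>d. c' i * A i $$ (z, y))) =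
    (\<Sum>i\<le>d. c'' i * A i $$ (x, y))"
proof -
  have prim: "primitive_idempotent N (adjacency_algebra N d A) (E i)" if "i \<le> d" for i
    using E that unfolding scheme_idempotents_def bij_betw_def by auto
  then have car: "E i \<in> carrier_mat N N" if "i \<le> d" for i
    using that adjacency_algebra_carrier by (auto simp: primitive_idempotent_def)
  have EE: "E i * E j = (if i = j then E i else 0\<^sub>m N N)" if "i \<le> d" "j \<le> d" for i j
  proof (cases "i = j")
    case True
    then show ?thesis using prim[OF that(1)] by (simp add: primitive_idempotent_def)
  next
    case False
    then have "E i \<noteq> E j"
      using E that unfolding scheme_idempotents_def bij_betw_def inj_on_def by auto
    then show ?thesis
      using False primitive_idempotents_orthogonal prim that by auto
  qed
  \<comment> \<open>The eigenvalue on \<open>E i\<close> of the combination with coefficients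
    \<open>c\<close>; \<open>conv\<close> below passes from the adjacency matrices to the
    idempotents.\<close>
  define ev where "ev c i = (\<Sum>j\<le>d. c j * P $$ (i, j))" for c i
  have conv: "mat_lincomb N d c A = mat_lincomb N d (ev c) E" for c
  proof (rule eq_matI)
    fix x y
    assume "x < dim_row (mat_lincomb N d (ev c) E)" "y < dim_col (mat_lincomb N d (ev c) E)"
    then have xy: "x < N" "y < N" by simp_all
    have "A j $$ (x, y) = (\<Sum>i\<le>d. P $$ (i, j) * E i $$ (x, y))" if "j \<le> d" for j
    proof -
      have "A j = mat_lincomb N d (\<lambda>i. P $$ (i, j)) E"
        using P that by (simp add: is_first_eigenmatrix_def)
      then show ?thesis using xy by simp
    qed
    then have "mat_lincomb N d c A $$ (x, y) =
        (\<Sum>j\<le>d. \<Sum>i\<le>d. c j * P $$ (i, j) * E i $$ (x, y))"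
      using xy by (simp add: sum_distrib_left mult_ac)
    also have "\<dots> = (\<Sum>i\<le>d. \<Sum>j\<le>d. c j * P $$ (i, j) * E i $$ (x, y))"
      by (rule sum.swap)
    finally show "mat_lincomb N d c A $$ (x, y) = mat_lincomb N d (ev c) E $$ (x, y)"
      using xy by (simp add: ev_def sum_distrib_right)
  qed simp_all
  have "(\<Sum>z<N. (\<Sum>i\<le>d. c i * A i $$ (x, z)) * (\<Sum>i\<le>d. c' i * A i $$ (z, y))) =
      (mat_lincomb N d c A * mat_lincomb N d c' A) $$ (x, y)"
    using xy by (subst times_mat_index_sum[where N = N]) auto
  also have "\<dots> = (\<Sum>i\<le>d. \<Sum>j\<le>d. ev c i * ev c' j * (E i * E j) $$ (x, y))"
    unfolding conv by (rule mat_lincomb_times_index[OF car car xy])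
  also have "\<dots> = (\<Sum>i\<le>d. \<Sum>j\<le>d. if i = j then ev c i * ev c' i * E i $$ (x, y) else 0)"
    using xy by (intro sum.cong refl) (simp add: EE)
  also have "\<dots> = (\<Sum>i\<le>d. ev c'' i * E i $$ (x, y))"
    using assms(3) by (simp add: ev_def)
  also have "\<dots> = mat_lincomb N d c'' A $$ (x, y)"
    unfolding conv using xy by simp
  finally show ?thesis using xy by simp
qed

text \<open>The 0/1 entries at a fixed position sum to 1, so exactly one matrix has a 1 there. The
  quantifier over \<open>c\<close> stands inside so that a single \<open>k\<close> serves all
  coefficient functions.\<close>

lemma scheme_relation_exists:
  assumes xy: "x < N" "y < N"
  shows "\<exists>k\<le>d. \<forall>c. (\<Sum>i\<le>d. c i * A i $$ (x, y)) = c k"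
proof -
  have "\<exists>k\<le>d. A k $$ (x, y) \<noteq> 0"
  proof (rule ccontr)
    assume "\<not> ?thesis"
    then have "(\<Sum>i\<le>d. A i $$ (x, y)) = 0" by simp
    then show False using scheme_sum_entries[OF xy] by simp
  qed
  then obtain k where k: "k \<le> d" "A k $$ (x, y) = 1"
    using scheme_entry xy by blast
  \<comment> \<open>The matrix \<open>A k\<close> already uses up the total 1; the remaining
    nonnegative entries sum to zero and hence all vanish.\<close>
  have "(\<Sum>i\<in>{..d} - {k}. A i $$ (x, y)) = 0"
    using scheme_sum_entries[OF xy] k by (simp add: sum_diff1)
  then have "\<forall>i\<in>{..d} - {k}. A i $$ (x, y) = 0"
    using scheme_entry xy by (subst (asm) sum_nonneg_eq_0_iff) fastforce+
  then have "(\<Sum>i\<le>d. c i * A i $$ (x, y)) = (\<Sum>i\<in>{k}. c i * A i $$ (x, y))" for c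
    using k by (intro sum.mono_neutral_right) auto
  then show ?thesis using k by auto
qed

text \<open>The index \<open>col x y\<close> of the relation containing \<open>(x, y)\<close> turns identities in the adjacency
  algebra into identities between finite sums, to be checked on the eigenvalues.\<close>

lemma scheme_colouring:
  assumes E: "scheme_idempotents N d A E" and P: "is_first_eigenmatrix N d A E P"
  obtains col :: "nat \<Rightarrow> nat \<Rightarrow> nat" where
    "\<And>x y. x < N \<Longrightarrow> y < N \<Longrightarrow> col x y \<le> d"
    "\<And>x y. x < N \<Longrightarrow> y < N \<Longrightarrow> col x y = col y x"
    "\<And>x y. x < N \<Longrightarrow> y < N \<Longrightarrow> col x y = 0 \<longleftrightarrow> x = y"
    "\<And>c c' c'' x y. x < N \<Longrightarrow> y < N \<Longrightarrow>
      (\<And>i. i \<le> d \<Longrightarrow>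
        (\<Sum>j\<le>d. c j * P $$ (i, j)) * (\<Sum>j\<le>d. c' j * P $$ (i, j)) = (\<Sum>j\<le>d. c'' j * P $$ (i, j)))
      \<Longrightarrow> (\<Sum>z<N. c (col x z) * c' (col z y)) = c'' (col x y)"
proof -
  obtain col where col: "\<And>x y. x < N \<Longrightarrow> y < N \<Longrightarrow> col x y \<le> d"
      "\<And>c x y. x < N \<Longrightarrow> y < N \<Longrightarrow> (\<Sum>i\<le>d. c i * A i $$ (x, y)) = c (col x y)"
    using scheme_relation_exists by metis
  have sym: "col x y = col y x" if xy: "x < N" "y < N" for x y
  proof -
    \<comment> \<open>With the index itself as coefficient, the combination recovers the colour from
      the entries, so symmetry of the matrices carries over to \<open>col\<close>.\<close>
    have "real (col x y) = (\<Sum>i\<le>d. real i * A i $$ (x, y))"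
      using xy by (simp add: col(2))
    also have "\<dots> = (\<Sum>i\<le>d. real i * A i $$ (y, x))"
      using xy by (intro sum.cong refl) (simp add: scheme_sym)
    also have "\<dots> = real (col y x)"
      using xy by (simp add: col(2))
    finally show ?thesis by simp
  qed
  have zero: "col x y = 0 \<longleftrightarrow> x = y" if xy: "x < N" "y < N" for x y
  proof -
    \<comment> \<open>The indicator of index 0 as coefficient singles out \<open>A 0\<close>, which
      is the identity matrix.\<close>
    have "of_bool (col x y = 0) = (\<Sum>i\<le>d. of_bool (i = 0) * A i $$ (x, y))"
      using xy col(2)[where c = "\<lambda>i. of_bool (i = 0)"] by simp
    also have "\<dots> = (\<Sum>i\<in>{0}. of_bool (i = 0) * A i $$ (x, y))"
      by (intro sum.mono_neutral_right) auto
    also have "\<dots> = of_bool (x = y)"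
      using xy scheme by (simp add: symmetric_assoc_scheme_def)
    finally show ?thesis by (cases "x = y"; cases "col x y = 0") simp_all
  qed
  have prod: "(\<Sum>z<N. c (col x z) * c' (col z y)) = c'' (col x y)"
    if xy: "x < N" "y < N" and ev: "\<And>i. i \<le> d \<Longrightarrow>
        (\<Sum>j\<le>d. c j * P $$ (i, j)) * (\<Sum>j\<le>d. c' j * P $$ (i, j)) = (\<Sum>j\<le>d. c'' j * P $$ (i, j))"
    for c c' c'' x y
  proof -
    have "(\<Sum>z<N. c (col x z) * c' (col z y)) =
      (\<Sum>z<N. (\<Sum>i\<le>d. c i * A i $$ (x, z)) * (\<Sum>i\<le>d. c' i * A i $$ (z, y)))"
      using xy by (intro sum.cong refl) (simp add: col(2))
    also have "\<dots> = c'' (col x y)"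
      using mat_lincomb_times_eigenvalues[OF E P ev xy] col(2)[OF xy] by simp
    finally show ?thesis .
  qed
  show thesis
    by (rule that[of col]) (fact col(1) sym zero prod)+
qed

end

section \<open>Restricting a multiple of a projection to a principal block\<close>

text \<open>If \<open>G\<close> is \<open>t * q\<close> times a projection and \<open>Y\<close> carries a principal block \<open>t * I\<close> of the same
  trace, the Schur complement of that block is a projection of trace zero up to scaling, hence
  vanishes. Concretely, the squared Frobenius norm of the difference of both sides is zero.\<close>

lemma gram_restrict:
  fixes G :: "'a \<Rightarrow> 'a \<Rightarrow> real"
  assumes X: "finite X" "Y \<subseteq> X" and card: "real (card X) = q * real (card Y)"
    and sym: "\<And>x y. x \<in> X \<Longrightarrow> y \<in> X \<Longrightarrow> G x y = G y x"
    and diag: "\<And>x. x \<in> X \<Longrightarrow> G x x = t"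
    and off: "\<And>x y. x \<in> Y \<Longrightarrow> y \<in> Y \<Longrightarrow> x \<noteq> y \<Longrightarrow> G x y = 0"
    and sq: "\<And>x y. x \<in> X \<Longrightarrow> y \<in> X \<Longrightarrow> (\<Sum>z\<in>X. G x z * G z y) = t * q * G x y"
    and xy: "x \<in> X" "y \<in> X"
  shows "(\<Sum>z\<in>Y. G x z * G z y) = t * G x y"
proof -
  have fY: "finite Y" using X finite_subset by blast
  have YX: "z \<in> X" if "z \<in> Y" for z using X that by blast
  \<comment> \<open>\<open>S\<close> is the product of the columns of \<open>G\<close> indexed by
    \<open>Y\<close> with the rows indexed by \<open>Y\<close>. The sums \<open>GG\<close>,
    \<open>SG\<close>, \<open>SS\<close> are the traces of the squares and of the mixed product, by
    symmetry.\<close>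
  define S where "S x y = (\<Sum>z\<in>Y. G x z * G z y)" for x y
  have GG: "(\<Sum>x\<in>X. \<Sum>y\<in>X. G x y * G x y) = t\<^sup>2 * q * real (card X)"
  proof -
    have "(\<Sum>y\<in>X. G x y * G x y) = t * q * t" if "x \<in> X" for x
      using sq[OF that that] sym that diag by simp
    then show ?thesis by (simp add: power2_eq_square)
  qed
  have SG: "(\<Sum>x\<in>X. \<Sum>y\<in>X. S x y * G x y) = t ^ 3 * q\<^sup>2 * real (card Y)"
  proof -
    have "(\<Sum>y\<in>X. S x y * G x y) = (\<Sum>z\<in>Y. t * q * (G x z * G x z))" if "x \<in> X" for x
    proof -
      have "(\<Sum>y\<in>X. S x y * G x y) = (\<Sum>y\<in>X. \<Sum>z\<in>Y. G x z * (G z y * G y x))"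
        unfolding S_def using that YX
        by (intro sum.cong refl) (simp add: sum_distrib_right mult.assoc sym)
      also have "\<dots> = (\<Sum>z\<in>Y. G x z * (\<Sum>y\<in>X. G z y * G y x))"
        by (subst sum.swap) (simp add: sum_distrib_left)
      also have "\<dots> = (\<Sum>z\<in>Y. t * q * (G x z * G x z))"
        using that YX by (intro sum.cong refl) (simp add: sq sym)
      finally show ?thesis .
    qed
    then have "(\<Sum>x\<in>X. \<Sum>y\<in>X. S x y * G x y) = (\<Sum>x\<in>X. \<Sum>z\<in>Y. t * q * (G x z * G x z))"
      by simp
    also have "\<dots> = (\<Sum>z\<in>Y. t * q * (\<Sum>x\<in>X. G z x * G x z))"
      using YX by (subst sum.swap) (simp add: sum_distrib_left sym)
    also have "\<dots> = (\<Sum>z\<in>Y. t * q * (t * q * t))"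
      using YX by (intro sum.cong refl) (simp add: sq diag)
    finally show ?thesis by (simp add: power2_eq_square power3_eq_cube)
  qed
  have SS: "(\<Sum>x\<in>X. \<Sum>y\<in>X. S x y * S x y) = t ^ 4 * q\<^sup>2 * real (card Y)"
  proof -
    have "(\<Sum>x\<in>X. \<Sum>y\<in>X. S x y * S x y) =
        (\<Sum>x\<in>X. \<Sum>y\<in>X. \<Sum>z\<in>Y. \<Sum>w\<in>Y. (G z x * G x w) * (G z y * G y w))"
      unfolding S_def sum_product using YX
      by (intro sum.cong refl) (simp add: sym mult_ac)
    also have "\<dots> = (\<Sum>x\<in>X. \<Sum>z\<in>Y. \<Sum>y\<in>X. \<Sum>w\<in>Y. (G z x * G x w) * (G z y * G y w))"
      by (intro sum.cong sum.swap refl)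
    also have "\<dots> = (\<Sum>z\<in>Y. \<Sum>x\<in>X. \<Sum>y\<in>X. \<Sum>w\<in>Y. (G z x * G x w) * (G z y * G y w))"
      by (rule sum.swap)
    also have "\<dots> = (\<Sum>z\<in>Y. \<Sum>x\<in>X. \<Sum>w\<in>Y. \<Sum>y\<in>X. (G z x * G x w) * (G z y * G y w))"
      by (intro sum.cong sum.swap refl)
    also have "\<dots> = (\<Sum>z\<in>Y. \<Sum>w\<in>Y. \<Sum>x\<in>X. \<Sum>y\<in>X. (G z x * G x w) * (G z y * G y w))"
      by (intro sum.cong sum.swap refl)
    also have "\<dots> = (\<Sum>z\<in>Y. \<Sum>w\<in>Y. (\<Sum>x\<in>X. G z x * G x w) * (\<Sum>y\<in>X. G z y * G y w))"
      by (simp add: sum_product)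
    \<comment> \<open>Both inner sums are entries of the square of \<open>G\<close> at points of
      \<open>Y\<close>, where \<open>G\<close> is \<open>t\<close> times the identity.\<close>
    also have "\<dots> = (\<Sum>z\<in>Y. \<Sum>w\<in>Y. if z = w then (t * q * t) * (t * q * t) else 0)"
      using YX by (intro sum.cong refl) (simp add: sq diag off)
    also have "\<dots> = t ^ 4 * q\<^sup>2 * real (card Y)"
      using fY by (simp add: power2_eq_square power4_eq_xxxx)
    finally show ?thesis .
  qed
  have "(\<Sum>x\<in>X. \<Sum>y\<in>X. (S x y - t * G x y)\<^sup>2) =
      (\<Sum>x\<in>X. \<Sum>y\<in>X. S x y * S x y) - 2 * t * (\<Sum>x\<in>X. \<Sum>y\<in>X. S x y * G x y)
      + t\<^sup>2 * (\<Sum>x\<in>X. \<Sum>y\<in>X. G x y * G x y)"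
    by (simp add: sum_distrib_left sum_subtractf[symmetric] sum.distrib[symmetric]
        power2_eq_square algebra_simps)
  \<comment> \<open>After replacing \<open>card X\<close> by \<open>q * card Y\<close>, the three
    terms are 1, -2 and 1 times \<open>t ^ 4 * q\<^sup>2 * card Y\<close>.\<close>
  also have "\<dots> = 0"
    unfolding SS SG GG card by (simp add: power2_eq_square power3_eq_cube power4_eq_xxxx)
  finally have "\<forall>x\<in>X. (\<Sum>y\<in>X. (S x y - t * G x y)\<^sup>2) = 0"
    using X by (subst (asm) sum_nonneg_eq_0_iff) (auto intro: sum_nonneg)
  then have "(\<Sum>y\<in>X. (S x y - t * G x y)\<^sup>2) = 0" using xy by blast
  then have "(S x y - t * G x y)\<^sup>2 = 0"
    using X xy by (subst (asm) sum_nonneg_eq_0_iff) auto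
  then show ?thesis by (simp add: S_def)
qed

section \<open>Grid coordinates for two equivalence relations, and assembly of the Bush-type
  matrices\<close>

lemma card_quotient_uniform:
  assumes X: "finite X" "equiv X r" and k: "\<And>x. x \<in> X \<Longrightarrow> card (r `` {x}) = k"
  shows "k * card (X // r) = card X"
proof -
  have "finite (X // r)"
    using X by (simp add: equiv_type finite_quotient)
  moreover have "card C = k" if "C \<in> X // r" for C
    using that k by (auto elim: quotientE)
  moreover have "C \<inter> D = {}" if "C \<in> X // r" "D \<in> X // r" "C \<noteq> D" for C D
    using that quotient_disj X by metis
  ultimately have "k * card (X // r) = card (\<Union> (X // r))"
    using X by (intro card_partition) (auto simp: Union_quotient)
  then show ?thesis using X by (simp add: Union_quotient)
qed

text \<open>Each B-class is numbered so that consecutive stretches of \<open>s\<close> indices are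
  its intersections with the R-classes. One listing \<open>D\<close> is shared by all B-classes, so
  the same block index in two B-classes means the same R-class; this puts the all-ones blocks on the
  diagonal later.\<close>

lemma grid_coordinates:
  assumes X: "finite X" "equiv X B" "equiv X R"
    and cB: "card (X // B) = M" and cR: "card (X // R) = r"
    and cell: "\<And>x y. x \<in> X \<Longrightarrow> y \<in> X \<Longrightarrow> card (R `` {x} \<inter> B `` {y}) = s"
  obtains C D and \<psi> :: "nat \<Rightarrow> nat \<Rightarrow> 'a" where
    "bij_betw C {..<M} (X // B)" "bij_betw D {..<r} (X // R)"
    "\<And>a. a < M \<Longrightarrow> bij_betw (\<psi> a) {..<r * s} (C a)"
    "\<And>a i. a < M \<Longrightarrow> i < r \<Longrightarrow> bij_betw (\<lambda>t. \<psi> a (s * i + t)) {..<s} (D i \<inter> C a)"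
proof -
  have "finite (X // B)" "finite (X // R)"
    using X by (simp_all add: equiv_type finite_quotient)
  then obtain C D where C: "bij_betw C {..<M} (X // B)" and D: "bij_betw D {..<r} (X // R)"
    using ex_bij_betw_nat_finite cB cR unfolding lessThan_atLeast0 by metis
  have CX: "C a \<in> X // B" if "a < M" for a
    using C that by (auto simp: bij_betw_def)
  have DX: "D i \<in> X // R" if "i < r" for i
    using D that by (auto simp: bij_betw_def)
  have "\<exists>h. bij_betw h {..<s} (D i \<inter> C a)" if a: "a < M" and i: "i < r" for a i
  proof -
    obtain x where "x \<in> X" "D i = R `` {x}"
      using DX[OF i] by (rule quotientE)
    moreover obtain y where "y \<in> X" "C a = B `` {y}"
      using CX[OF a] by (rule quotientE)
    moreover have "finite (B `` {y})"
      using X(1) equiv_type[OF X(2)] by (auto elim!: finite_subset[rotated])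
    ultimately show ?thesis
      using cell ex_bij_betw_nat_finite[of "D i \<inter> C a"] by (simp add: lessThan_atLeast0)
  qed
  then obtain h where h: "\<And>a i. a < M \<Longrightarrow> i < r \<Longrightarrow> bij_betw (h a i) {..<s} (D i \<inter> C a)"
    by metis
  \<comment> \<open>Division with remainder: the quotient of \<open>k\<close> by \<open>s\<close>
    chooses the R-class, the remainder the place inside the cell.\<close>
  define \<psi> where "\<psi> a k = h a (k div s) (k mod s)" for a k
  have block: "bij_betw (\<lambda>t. \<psi> a (s * i + t)) {..<s} (D i \<inter> C a)" if "a < M" "i < r" for a i
    using h[OF that] by (subst bij_betw_cong[where g = "h a i"]) (auto simp: \<psi>_def)
  have "bij_betw (\<psi> a) {..<r * s} (C a)" if a: "a < M" for a
  proof -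
    have div: "k div s < r" "k mod s < s" if "k < r * s" for k
      using that by (auto simp: less_mult_imp_div_less intro!: mod_less_divisor gr0I)
    have mem: "\<psi> a k \<in> D (k div s) \<inter> C a" if "k < r * s" for k
      using h[OF a div(1)[OF that]] div(2)[OF that] by (auto simp: \<psi>_def bij_betw_def)
    have "inj_on (\<psi> a) {..<r * s}"
    proof (rule inj_onI)
      fix k l
      assume kl: "k \<in> {..<r * s}" "l \<in> {..<r * s}" "\<psi> a k = \<psi> a l"
      have k: "k div s < r" "k mod s < s" and l: "l div s < r" "l mod s < s"
        using kl div by auto
      have "D (k div s) \<inter> D (l div s) \<noteq> {}"
        using mem[of k] mem[of l] kl by auto
      then have "D (k div s) = D (l div s)"
        using quotient_disj[OF X(3) DX[OF k(1)] DX[OF l(1)]] by blast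
      then have eq: "k div s = l div s"
        using D k l by (auto simp: bij_betw_def inj_on_def)
      then have "k mod s = l mod s"
        using h[OF a k(1)] k l kl(3) by (auto simp: \<psi>_def bij_betw_def inj_on_def)
      with eq show "k = l" by (metis div_mult_mod_eq)
    qed
    moreover have "\<psi> a ` {..<r * s} = C a"
    proof (intro equalityI subsetI)
      fix y assume y: "y \<in> C a"
      then have "y \<in> X" using CX[OF a] X by (metis Union_quotient UnionI)
      then have "y \<in> \<Union> (X // R)" using X by (simp add: Union_quotient)
      then obtain i where i: "i < r" "y \<in> D i"
        using D by (auto simp: bij_betw_def)
      then obtain t where t: "t < s" "y = \<psi> a (s * i + t)"
        using block[OF a i(1)] y by (auto simp: bij_betw_def)
      have "s * i + t < s * Suc i" using t by simp
      also have "\<dots> \<le> s * r" using i by (intro mult_le_mono2) simp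
      finally show "y \<in> \<psi> a ` {..<r * s}" using t by (auto simp: mult.commute)
    qed (use mem in auto)
    ultimately show ?thesis by (simp add: bij_betw_def)
  qed
  then show thesis using that C D block by blast
qed

text \<open>Collects what the construction needs to know about \<open>G\<close>, independently of
  schemes. Class \<open>C 0\<close> is the reference, and each other class \<open>C a\<close>
  contributes the block of \<open>G\<close> between \<open>C a\<close> and
  \<open>C 0\<close>.\<close>

lemma bush_type_from_blocks:
  fixes G :: "'a \<Rightarrow> 'a \<Rightarrow> real" and n M :: nat
  assumes n: "n \<ge> 1"
    and X: "finite X" "equiv X B" "equiv X R"
    and cB: "card (X // B) = Suc M" and cR: "card (X // R) = 2 * n"
    and cell: "\<And>x y. x \<in> X \<Longrightarrow> y \<in> X \<Longrightarrow> card (R `` {x} \<inter> B `` {y}) = 2 * n"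
    and sym: "\<And>x y. x \<in> X \<Longrightarrow> y \<in> X \<Longrightarrow> G x y = G y x"
    and diag: "\<And>x. x \<in> X \<Longrightarrow> G x x = 2 * n"
    and in_B: "\<And>x y. (x, y) \<in> B \<Longrightarrow> x \<noteq> y \<Longrightarrow> G x y = 0"
    and off_B: "\<And>x y. x \<in> X \<Longrightarrow> y \<in> X \<Longrightarrow> (x, y) \<notin> B \<Longrightarrow> G x y \<in> {-1, 1}"
    and in_R: "\<And>x y. (x, y) \<in> R \<Longrightarrow> (x, y) \<notin> B \<Longrightarrow> G x y = 1"
    and gram: "\<And>x y C. x \<in> X \<Longrightarrow> y \<in> X \<Longrightarrow> C \<in> X // B \<Longrightarrow>
      (\<Sum>z\<in>C. G x z * G z y) = 2 * n * G x y"
    and zero: "\<And>x C D. x \<in> X \<Longrightarrow> C \<in> X // B \<Longrightarrow> D \<in> X // R \<Longrightarrow> x \<notin> C \<Longrightarrow> x \<notin> D \<Longrightarrow>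
      (\<Sum>z\<in>D \<inter> C. G x z) = 0"
  shows "\<exists>S. finite S \<and> card S = M \<and> (\<forall>H\<in>S. bush_type_hadamard n H) \<and>
    mutually_unbiased (4 * n\<^sup>2) S"
proof -
  \<comment> \<open>The same number is the count of R-classes and the size of a cell, so every
    B-class has \<open>s * s\<close> points.\<close>
  define s where "s = 2 * n"
  have s: "4 * n\<^sup>2 = s * s" "s > 0" using n by (auto simp: s_def power2_eq_square)
  obtain C D and \<psi> :: "nat \<Rightarrow> nat \<Rightarrow> 'a" where
    C: "bij_betw C {..<Suc M} (X // B)" and D: "bij_betw D {..<s} (X // R)"
    and \<psi>: "\<And>a. a < Suc M \<Longrightarrow> bij_betw (\<psi> a) {..<s * s} (C a)"
    and \<psi>_block: "\<And>a i. a < Suc M \<Longrightarrow> i < s \<Longrightarrow>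
      bij_betw (\<lambda>t. \<psi> a (s * i + t)) {..<s} (D i \<inter> C a)"
    using grid_coordinates[OF X cB cR cell] unfolding s_def by metis
  have CX: "C a \<in> X // B" if "a < Suc M" for a
    using C that by (auto simp: bij_betw_def)
  have DX: "D i \<in> X // R" if "i < s" for i
    using D that by (auto simp: bij_betw_def)
  have \<psi>C: "\<psi> a k \<in> C a" if "a < Suc M" "k < s * s" for a k
    using \<psi>[OF that(1)] that by (auto simp: bij_betw_def)
  have \<psi>X: "\<psi> a k \<in> X" if "a < Suc M" "k < s * s" for a k
    using \<psi>C[OF that] CX[OF that(1)] X by (metis Union_quotient UnionI)
  have \<psi>D: "\<psi> a (s * i + t) \<in> D i" if "a < Suc M" "i < s" "t < s" for a i t
    using \<psi>_block[OF that(1,2)] that by (auto simp: bij_betw_def)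
  have idx: "s * i + t < s * s" if "i < s" "t < s" for i t
  proof -
    have "s * i + t < s * Suc i" using that by simp
    also have "\<dots> \<le> s * s" using that by (intro mult_le_mono2) simp
    finally show ?thesis .
  qed
  have C_inj: "C a \<inter> C b = {}" if "a < Suc M" "b < Suc M" "a \<noteq> b" for a b
    using quotient_disj[OF X(2) CX[OF that(1)] CX[OF that(2)]] C that
    by (auto simp: bij_betw_def inj_on_def)
  have D_inj: "D a \<inter> D b = {}" if "a < s" "b < s" "a \<noteq> b" for a b
    using quotient_disj[OF X(3) DX[OF that(1)] DX[OF that(2)]] D that
    by (auto simp: bij_betw_def inj_on_def)
  have \<psi>B: "(\<psi> a k, \<psi> b l) \<in> B \<longleftrightarrow> a = b"
    if "a < Suc M" "b < Suc M" "k < s * s" "l < s * s" for a b k l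
    using quotient_eq_iff[OF X(2) CX CX \<psi>C \<psi>C] that C_inj \<psi>C by blast
  have \<psi>R: "(\<psi> a (s * i + t), \<psi> b (s * i + u)) \<in> R"
    if "a < Suc M" "b < Suc M" "i < s" "t < s" "u < s" for a b i t u
    using quotient_eq_iff[OF X(3) DX DX \<psi>D \<psi>D] that by blast
  \<comment> \<open>Block of \<open>G\<close> between two B-classes in grid coordinates; in
    particular \<open>H a a\<close> is 2n times the identity.\<close>
  define H where "H a b = mat (s * s) (s * s) (\<lambda>(k, l). G (\<psi> a k) (\<psi> b l))" for a b
  have sum_C: "(\<Sum>l<s * s. G (\<psi> a k) (\<psi> c l) * G (\<psi> b k') (\<psi> c l)) =
      2 * n * G (\<psi> a k) (\<psi> b k')"
    if "a < Suc M" "b < Suc M" "c < Suc M" "k < s * s" "k' < s * s" for a b c k k'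
  proof -
    have "(\<Sum>l<s * s. G (\<psi> a k) (\<psi> c l) * G (\<psi> b k') (\<psi> c l)) =
        (\<Sum>l<s * s. G (\<psi> a k) (\<psi> c l) * G (\<psi> c l) (\<psi> b k'))"
      using that by (intro sum.cong refl) (simp add: sym \<psi>X)
    also have "\<dots> = (\<Sum>z\<in>C c. G (\<psi> a k) z * G z (\<psi> b k'))"
      using sum.reindex_bij_betw[OF \<psi>[OF that(3)], of "\<lambda>z. G (\<psi> a k) z * G z (\<psi> b k')"] .
    finally show ?thesis using gram that \<psi>X CX by simp
  qed
  have had: "hadamard_mat (s * s) (H a b)" if ab: "a < Suc M" "b < Suc M" "a \<noteq> b" for a b
    unfolding hadamard_mat_def
  proof (intro conjI allI impI)
    have "G (\<psi> a k) (\<psi> b l) \<in> {-1, 1}" if "k < s * s" "l < s * s" for k l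
      using ab that by (intro off_B \<psi>X) (simp_all add: \<psi>B)
    then show "elements_mat (H a b) \<subseteq> {-1, 1}"
      unfolding elements_mat_def by (fastforce simp: H_def)
  next
    fix i j assume ij: "i < s * s" "j < s * s" "i \<noteq> j"
    \<comment> \<open>By \<open>gram\<close> this inner product is 2n times the entry of
      \<open>G\<close> at two distinct points of the single class \<open>C a\<close>, where
      \<open>in_B\<close> applies.\<close>
    have "row (H a b) i \<bullet> row (H a b) j =
        (\<Sum>l<s * s. G (\<psi> a i) (\<psi> b l) * G (\<psi> a j) (\<psi> b l))"
      using ij by (auto simp: scalar_prod_def H_def lessThan_atLeast0 intro!: sum.cong)
    also have "\<dots> = 2 * n * G (\<psi> a i) (\<psi> a j)"
      using ab ij by (simp add: sum_C)
    also have "\<psi> a i \<noteq> \<psi> a j"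
      using \<psi>[OF ab(1)] ij by (auto simp: bij_betw_def inj_on_def)
    then have "G (\<psi> a i) (\<psi> a j) = 0"
      using ab ij by (intro in_B) (simp add: \<psi>B)
    finally show "row (H a b) i \<bullet> row (H a b) j = 0" by simp
  qed (simp add: H_def)
  have prod: "H a 0 * transpose_mat (H b 0) = real (2 * n) \<cdot>\<^sub>m H a b"
    if "a < Suc M" "b < Suc M" for a b
  proof (rule eq_matI)
    fix i j assume "i < dim_row (real (2 * n) \<cdot>\<^sub>m H a b)" "j < dim_col (real (2 * n) \<cdot>\<^sub>m H a b)"
    then have ij: "i < s * s" "j < s * s" by (simp_all add: H_def)
    have "(H a 0 * transpose_mat (H b 0)) $$ (i, j) =
        (\<Sum>l<s * s. H a 0 $$ (i, l) * transpose_mat (H b 0) $$ (l, j))"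
      using ij by (intro times_mat_index_sum) (auto simp: H_def)
    also have "\<dots> = (\<Sum>l<s * s. G (\<psi> a i) (\<psi> 0 l) * G (\<psi> b j) (\<psi> 0 l))"
      using ij by (intro sum.cong refl) (simp add: H_def)
    also have "\<dots> = 2 * n * G (\<psi> a i) (\<psi> b j)"
      using ij that by (simp add: sum_C)
    finally show "(H a 0 * transpose_mat (H b 0)) $$ (i, j) = (real (2 * n) \<cdot>\<^sub>m H a b) $$ (i, j)"
      using ij by (simp add: H_def)
  qed (simp_all add: H_def)
  have bush: "bush_type_hadamard n (H a 0)" if a: "0 < a" "a < Suc M" for a
    unfolding bush_type_hadamard_def s_def[symmetric] s(1)
  proof (intro conjI allI impI)
    show "hadamard_mat (s * s) (H a 0)" using a by (intro had) auto
  next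
    fix i assume i: "i < s"
    \<comment> \<open>Equal block indices give points of the same R-class, and \<open>a\<close>
      being nonzero puts them in different B-classes.\<close>
    have "G (\<psi> a (s * i + x)) (\<psi> 0 (s * i + y)) = 1" if "x < s" "y < s" for x y
      using a i that by (intro in_R \<psi>R) (simp_all add: \<psi>B idx)
    then show "mat_block s (H a 0) i i = all_ones_mat s"
      using i by (intro eq_matI) (simp_all add: mat_block_def all_ones_mat_def H_def idx)
  next
    fix i j assume ij: "i < s" "j < s" "i \<noteq> j"
    \<comment> \<open>A row sum of the block is a sum of \<open>G\<close> over the cell of
      \<open>D j\<close> and \<open>C 0\<close>, seen from a point in neither class, so
      \<open>zero\<close> applies.\<close>
    have "(mat_block s (H a 0) i j * all_ones_mat s) $$ (x, y) = 0" if xy: "x < s" "y < s" for x y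
    proof -
      have "(mat_block s (H a 0) i j * all_ones_mat s) $$ (x, y) =
          (\<Sum>t<s. G (\<psi> a (s * i + x)) (\<psi> 0 (s * j + t)))"
        using ij xy
        by (subst times_mat_index_sum[where N = s])
          (auto simp: mat_block_def all_ones_mat_def H_def idx)
      also have "\<dots> = (\<Sum>z\<in>D j \<inter> C 0. G (\<psi> a (s * i + x)) z)"
        using sum.reindex_bij_betw[OF \<psi>_block[of 0 j], of "G (\<psi> a (s * i + x))"] ij by simp
      also have "\<dots> = 0"
        using a ij xy C_inj[of a 0] D_inj[of i j] \<psi>C[of a "s * i + x"] \<psi>D[of a i x]
        by (intro zero \<psi>X CX DX) (auto simp: idx)
      finally show ?thesis .
    qed
    then show "mat_block s (H a 0) i j * all_ones_mat s = 0\<^sub>m s s"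
      by (intro eq_matI) (simp_all add: mat_block_def all_ones_mat_def)
    \<comment> \<open>Column sums are handled by symmetry of \<open>G\<close>: the summation now
      runs over the cell of \<open>D i\<close> and \<open>C a\<close>, seen from a point of
      \<open>C 0\<close>.\<close>
    have "(all_ones_mat s * mat_block s (H a 0) i j) $$ (x, y) = 0" if xy: "x < s" "y < s" for x y
    proof -
      have "(all_ones_mat s * mat_block s (H a 0) i j) $$ (x, y) =
          (\<Sum>t<s. G (\<psi> 0 (s * j + y)) (\<psi> a (s * i + t)))"
        using ij xy a
        by (subst times_mat_index_sum[where N = s])
          (auto simp: mat_block_def all_ones_mat_def H_def idx \<psi>X intro!: sum.cong sym)
      also have "\<dots> = (\<Sum>z\<in>D i \<inter> C a. G (\<psi> 0 (s * j + y)) z)"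
        using sum.reindex_bij_betw[OF \<psi>_block[of a i], of "G (\<psi> 0 (s * j + y))"] ij a by simp
      also have "\<dots> = 0"
        using a ij xy C_inj[of a 0] D_inj[of i j] \<psi>C[of 0 "s * j + y"] \<psi>D[of 0 j y]
        by (intro zero \<psi>X CX DX) (auto simp: idx)
      finally show ?thesis .
    qed
    then show "all_ones_mat s * mat_block s (H a 0) i j = 0\<^sub>m s s"
      by (intro eq_matI) (simp_all add: mat_block_def all_ones_mat_def)
  qed
  \<comment> \<open>Needed to count the matrices. If two agreed, \<open>prod\<close> would give
    \<open>H a a = H a b\<close>, but the first has corner entry 2n, which is at least 2, and the
    second has 1 or -1 there.\<close>
  have neq: "H a 0 \<noteq> H b 0" if ab: "a < Suc M" "b < Suc M" "a \<noteq> b" for a b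
  proof
    assume eq: "H a 0 = H b 0"
    have "real (2 * n) \<cdot>\<^sub>m H a a = real (2 * n) \<cdot>\<^sub>m H a b"
      using prod[OF ab(1,1)] prod[OF ab(1,2)] eq by simp
    then have "(real (2 * n) \<cdot>\<^sub>m H a a) $$ (0, 0) = (real (2 * n) \<cdot>\<^sub>m H a b) $$ (0, 0)"
      by simp
    then have "H a a $$ (0, 0) = H a b $$ (0, 0)"
      using n s by (simp add: H_def)
    moreover have "H a a $$ (0, 0) = 2 * n"
      using ab s by (simp add: H_def diag \<psi>X)
    moreover have "H a b $$ (0, 0) \<in> {-1, 1}"
      using off_B[OF \<psi>X \<psi>X, of a 0 b 0] ab s by (simp add: H_def \<psi>B)
    ultimately have "2 * real n = - 1 \<or> 2 * real n = 1" by simp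
    then show False using n by auto
  qed
  \<comment> \<open>Index 0 is left out because \<open>H 0 0\<close> is a multiple of the
    identity.\<close>
  define S where "S = (\<lambda>a. H a 0) ` {1..M}"
  have "inj_on (\<lambda>a. H a 0) {1..M}"
    using neq unfolding inj_on_def by (metis atLeastAtMost_iff le_imp_less_Suc)
  then have "card S = M" by (simp add: S_def card_image)
  moreover have "\<forall>H\<in>S. bush_type_hadamard n H"
    using bush by (auto simp: S_def)
  moreover have "mutually_unbiased (s * s) S"
    unfolding mutually_unbiased_def
  proof (intro conjI ballI impI)
    fix K L assume KL: "K \<in> S" "L \<in> S" "K \<noteq> L"
    then obtain a b where "a \<in> {1..M}" "b \<in> {1..M}" and ab: "K = H a 0" "L = H b 0"
      unfolding S_def by blast
    then have "a < Suc M" "b < Suc M" "a \<noteq> b" using KL by auto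
    note this ab
    \<comment> \<open>The factor 2n in \<open>prod\<close> is the square root of the order, and the
      Hadamard matrix witnessing unbiasedness is \<open>H a b\<close>.\<close>
    moreover have "sqrt (real (s * s)) = real (2 * n)"
      unfolding s_def[symmetric] by simp
    ultimately show "unbiased (s * s) K L"
      unfolding unbiased_def using had prod by metis
  qed (use had in \<open>auto simp: S_def\<close>)
  ultimately show ?thesis
    by (auto simp: s(1) S_def)
qed

section \<open>Equivalence relations from 0/1 matrices\<close>

lemma card_eq_sum_zero_one:
  fixes f :: "'a \<Rightarrow> real"
  assumes "finite X" "\<And>x. x \<in> X \<Longrightarrow> f x \<in> {0, 1}"
  shows "real (card {x \<in> X. f x = 1}) = (\<Sum>x\<in>X. f x)"
proof -
  have "(\<Sum>x\<in>X. f x) = (\<Sum>x\<in>{x \<in> X. f x = 1}. 1)"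
    using assms by (intro sum.mono_neutral_cong_right) auto
  then show ?thesis by simp
qed

text \<open>A path from \<open>x\<close> over \<open>y\<close> to \<open>z\<close> makes the square
  positive at that position, hence the entry there nonzero: this is transitivity. The class size is
  a diagonal entry of the square.\<close>

lemma square_proportional_equiv:
  fixes f :: "'a \<Rightarrow> 'a \<Rightarrow> real"
  assumes X: "finite X"
    and f01: "\<And>x y. x \<in> X \<Longrightarrow> y \<in> X \<Longrightarrow> f x y \<in> {0, 1}"
    and refl: "\<And>x. x \<in> X \<Longrightarrow> f x x = 1"
    and sym: "\<And>x y. x \<in> X \<Longrightarrow> y \<in> X \<Longrightarrow> f x y = f y x"
    and sq: "\<And>x y. x \<in> X \<Longrightarrow> y \<in> X \<Longrightarrow> (\<Sum>z\<in>X. f x z * f z y) = real c * f x y"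
  defines "r \<equiv> {(x, y). x \<in> X \<and> y \<in> X \<and> f x y = 1}"
  shows "equiv X r" and "\<And>x. x \<in> X \<Longrightarrow> card (r `` {x}) = c"
proof -
  have trans: "f x z = 1" if xyz: "x \<in> X" "y \<in> X" "z \<in> X" and "f x y = 1" "f y z = 1" for x y z
  proof -
    have "1 = f x y * f y z" using that by simp
    also have "\<dots> \<le> (\<Sum>y\<in>X. f x y * f y z)"
      using xyz f01 by (intro member_le_sum X) (fastforce intro!: mult_nonneg_nonneg)+
    also have "\<dots> = real c * f x z" using xyz by (intro sq)
    finally show ?thesis using f01[of x z] xyz by auto
  qed
  show "equiv X r"
  proof (rule equivI)
    show "sym r" using sym by (auto intro!: symI simp: r_def)
    show "trans r" using trans by (auto intro!: transI simp: r_def)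
  qed (auto simp: refl_on_def refl r_def)
  show "card (r `` {x}) = c" if x: "x \<in> X" for x
  proof -
    have "r `` {x} = {z \<in> X. f x z * f z x = 1}"
    proof -
      have "f x z = 1 \<longleftrightarrow> f x z * f z x = 1" if "z \<in> X" for z
        using f01[OF x that] sym[OF x that] by (cases "f x z = 1") auto
      then show ?thesis using x by (auto simp: r_def)
    qed
    also have "real (card \<dots>) = (\<Sum>z\<in>X. f x z * f z x)"
      using f01[OF x] f01[OF _ x] by (intro card_eq_sum_zero_one X) fastforce
    also have "\<dots> = real c" using x by (simp add: sq refl)
    finally show ?thesis by simp
  qed
qed

section \<open>Eigenvalues for the given first eigenmatrix, and the final construction\<close>

lemma sum_atMost_5:
  fixes f :: "nat \<Rightarrow> 'a::comm_monoid_add"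
  shows "(\<Sum>i\<le>5. f i) = f 0 + f 1 + f 2 + f 3 + f 4 + f 5"
  by (simp add: eval_nat_numeral)

text \<open>Evaluates the rows once for arbitrary coefficients, so that each matrix identity below
  becomes six polynomial identities in \<open>n\<close> and \<open>m\<close>.\<close>

lemma bush_P_row_sum:
  assumes "i \<le> 5"
  shows "(\<Sum>j\<le>5. c j * bush_P n m $$ (i, j)) =
    [c 0 + c 1 * (2*n - 1) + c 2 * (2*n*(2*n - 1)) + c 3 * (2*n*m) + (c 4 + c 5) * (n*(2*n - 1)*m),
     c 0 - c 1 + (c 4 - c 5) * (n*m),
     c 0 + c 1 * (2*n - 1) - c 2 * (2*n) + c 3 * (2*n*m) - (c 4 + c 5) * (n*m),
     c 0 + c 1 * (2*n - 1) - c 2 * (2*n) - c 3 * (2*n) + (c 4 + c 5) * n,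
     c 0 - c 1 - (c 4 - c 5) * n,
     c 0 + c 1 * (2*n - 1) + c 2 * (2*n*(2*n - 1)) - c 3 * (2*n) - (c 4 + c 5) * (n*(2*n - 1))] ! i"
proof -
  have "i = 0 \<or> i = 1 \<or> i = 2 \<or> i = 3 \<or> i = 4 \<or> i = 5" using assms by linarith
  then show ?thesis
    by (elim disjE) (simp_all add: sum_atMost_5 bush_P_def mat_of_rows_list_def algebra_simps)
qed

theorem theorem3p6:
  fixes n m :: nat
  assumes "n \<ge> 1" and "m \<ge> 2"
    and "\<exists>A E. symmetric_assoc_scheme (4 * n\<^sup>2 * (m + 1)) 5 A \<and>
           scheme_idempotents (4 * n\<^sup>2 * (m + 1)) 5 A E \<and>
           is_first_eigenmatrix (4 * n\<^sup>2 * (m + 1)) 5 A E (bush_P (real n) (real m)) \<and>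
           is_second_eigenmatrix (4 * n\<^sup>2 * (m + 1)) 5 A E (bush_Q (real n) (real m))"
  shows "\<exists>S. finite S \<and> card S = m \<and> (\<forall>H\<in>S. bush_type_hadamard n H) \<and>
           mutually_unbiased (4 * n\<^sup>2) S"
proof -
  define N where "N = 4 * n\<^sup>2 * (m + 1)"
  define ev where "ev c i = (\<Sum>j\<le>5. c j * bush_P (real n) (real m) $$ (i, j))" for c and i :: nat
  obtain A E where scheme: "symmetric_assoc_scheme N 5 A"
    and E: "scheme_idempotents N 5 A E"
    and P: "is_first_eigenmatrix N 5 A E (bush_P (real n) (real m))"
    using assms(3) unfolding N_def by blast
  obtain col where col_le: "\<And>x y. x < N \<Longrightarrow> y < N \<Longrightarrow> col x y \<le> 5"
    and col_sym: "\<And>x y. x < N \<Longrightarrow> y < N \<Longrightarrow> col x y = col y x"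
    and col_0: "\<And>x y. x < N \<Longrightarrow> y < N \<Longrightarrow> col x y = 0 \<longleftrightarrow> x = y"
    and col_sum: "\<And>c c' c'' x y. x < N \<Longrightarrow> y < N \<Longrightarrow>
      (\<And>i. i \<le> 5 \<Longrightarrow> ev c i * ev c' i = ev c'' i) \<Longrightarrow>
      (\<Sum>z<N. c (col x z) * c' (col z y)) = c'' (col x y)"
    by (fact scheme_colouring[OF scheme E P, folded ev_def])
  have le5: "i = 0 \<or> i = 1 \<or> i = 2 \<or> i = 3 \<or> i = 4 \<or> i = 5" if "i \<le> 5" for i :: nat
    using that by linarith
  note col_cases = le5[OF col_le]
  \<comment> \<open>Coefficient lists in the order of the relations: \<open>cC\<close> describes the
    intersection of B and R, \<open>cS\<close> is the fourth minus the fifth matrix, and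
    \<open>cG\<close> gives G. They are looked up at colours only, which are at most 5.\<close>
  define cB :: "nat \<Rightarrow> real" where "cB = (!) [1, 1, 1, 0, 0, 0]"
  define cR :: "nat \<Rightarrow> real" where "cR = (!) [1, 1, 0, 1, 0, 0]"
  define cC :: "nat \<Rightarrow> real" where "cC = (!) [1, 1, 0, 0, 0, 0]"
  define cS :: "nat \<Rightarrow> real" where "cS = (!) [0, 0, 0, 0, 1, -1]"
  define cG :: "nat \<Rightarrow> real" where "cG = (!) [2 * real n, 0, 0, 1, 1, -1]"
  note ev_eq = bush_P_row_sum[of _ _ "real n" "real m", folded ev_def]
  \<comment> \<open>The nonzero eigenvalues are 4n^2 on \<open>E 0\<close> and \<open>E 5\<close>
    for \<open>cB\<close>, and 2n(m+1) on \<open>E 0\<close> and \<open>E 2\<close> for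
    \<open>cR\<close>. Their only common idempotent is \<open>E 0\<close>, so the product in
    \<open>RB\<close> is a multiple of the all-ones matrix, whose coefficients are constant.\<close>
  have BB: "ev cB i * ev cB i = ev (\<lambda>k. real (4 * n\<^sup>2) * cB k) i" if "i \<le> 5" for i
    using le5[OF that] by (elim disjE)
      (simp_all add: ev_eq cB_def power2_eq_square algebra_simps)
  have RR: "ev cR i * ev cR i = ev (\<lambda>k. real (2 * n * (m + 1)) * cR k) i" if "i \<le> 5" for i
    using le5[OF that] by (elim disjE)
      (simp_all add: ev_eq cR_def power2_eq_square algebra_simps)
  have RB: "ev cR i * ev cB i = ev (\<lambda>k. real (2 * n)) i" if "i \<le> 5" for i
    using le5[OF that] by (elim disjE)
      (simp_all add: ev_eq cR_def cB_def power2_eq_square algebra_simps)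
  \<comment> \<open>The eigenvalues of \<open>cS\<close> vanish except on \<open>E 1\<close> and
    \<open>E 4\<close>, exactly where those of \<open>cC\<close> are zero.\<close>
  have SC: "ev cS i * ev cC i = ev (\<lambda>k. 0) i" if "i \<le> 5" for i
    using le5[OF that] by (elim disjE)
      (simp_all add: ev_eq cS_def cC_def power2_eq_square algebra_simps)
  \<comment> \<open>The eigenvalues of \<open>cG\<close> are 2n(m+1) on the first three idempotents
    and 0 on the other three.\<close>
  have GG: "ev cG i * ev cG i = ev (\<lambda>k. 2 * real n * real (m + 1) * cG k) i" if "i \<le> 5" for i
    using le5[OF that] by (elim disjE)
      (simp_all add: ev_eq cG_def power2_eq_square algebra_simps)
  define B where "B = {(x, y). x \<in> {..<N} \<and> y \<in> {..<N} \<and> cB (col x y) = 1}"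
  define R where "R = {(x, y). x \<in> {..<N} \<and> y \<in> {..<N} \<and> cR (col x y) = 1}"
  have cB01: "cB (col x y) \<in> {0, 1}" and cR01: "cR (col x y) \<in> {0, 1}"
    and cB_sym: "cB (col x y) = cB (col y x)" and cR_sym: "cR (col x y) = cR (col y x)"
    if "x \<in> {..<N}" "y \<in> {..<N}" for x y
    using col_cases[of x y] col_sym[of x y] that by (auto simp: cB_def cR_def)
  have cB_refl: "cB (col x x) = 1" and cR_refl: "cR (col x x) = 1" if "x \<in> {..<N}" for x
    using col_0[of x x] that by (simp_all add: cB_def cR_def)
  have sqB: "(\<Sum>z<N. cB (col x z) * cB (col z y)) = real (4 * n\<^sup>2) * cB (col x y)"
    and sqR: "(\<Sum>z<N. cR (col x z) * cR (col z y)) = real (2 * n * (m + 1)) * cR (col x y)"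
    if "x \<in> {..<N}" "y \<in> {..<N}" for x y
    using that col_sum[OF _ _ BB, of x y] col_sum[OF _ _ RR, of x y] by simp_all
  note B = square_proportional_equiv[OF finite_lessThan cB01 cB_refl cB_sym sqB, folded B_def]
  note R = square_proportional_equiv[OF finite_lessThan cR01 cR_refl cR_sym sqR, folded R_def]
  note card_B = B(2) and card_R = R(2)
  note B = B(1) and R = R(1)
  \<comment> \<open>The entry of the product of R and B at \<open>(x, y)\<close> counts the points
    of this cell.\<close>
  have cell: "card (R `` {x} \<inter> B `` {y}) = 2 * n" if xy: "x \<in> {..<N}" "y \<in> {..<N}" for x y
  proof -
    have "R `` {x} \<inter> B `` {y} = {z \<in> {..<N}. cR (col x z) * cB (col z y) = 1}"
    proof -
      have "cR (col x z) = 1 \<and> cB (col y z) = 1 \<longleftrightarrow> cR (col x z) * cB (col z y) = 1"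
        if "z \<in> {..<N}" for z
        using xy cR01[of x z] cB01[of z y] cB_sym[of y z] that
        by (cases "cR (col x z) = 1") auto
      then show ?thesis using xy by (auto simp: R_def B_def)
    qed
    also have "real (card \<dots>) = (\<Sum>z<N. cR (col x z) * cB (col z y))"
      using xy cR01[of x] cB01[of _ y] by (intro card_eq_sum_zero_one) fastforce+
    also have "\<dots> = real (2 * n)"
      using xy by (intro col_sum RB) auto
    finally show ?thesis by simp
  qed
  have quot_B: "card ({..<N} // B) = Suc m"
  proof -
    have "4 * n\<^sup>2 * card ({..<N} // B) = 4 * n\<^sup>2 * Suc m"
      using card_quotient_uniform[OF _ B card_B] by (simp add: N_def)
    then show ?thesis using assms(1) by (subst (asm) mult_cancel1) auto
  qed
  have quot_R: "card ({..<N} // R) = 2 * n"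
  proof -
    have "2 * n * (m + 1) * card ({..<N} // R) = 2 * n * (m + 1) * (2 * n)"
      using card_quotient_uniform[OF _ R card_R] by (simp add: N_def power2_eq_square algebra_simps)
    then show ?thesis using assms(1) by (subst (asm) mult_cancel1) auto
  qed
  show ?thesis
  proof (rule bush_type_from_blocks[OF assms(1) _ B R quot_B quot_R cell])
    show "cG (col x y) = cG (col y x)" if "x \<in> {..<N}" "y \<in> {..<N}" for x y
      using that by (simp add: col_sym)
    show diag: "cG (col x x) = 2 * n" if "x \<in> {..<N}" for x
      using that col_0[of x x] by (simp add: cG_def)
    show in_B: "cG (col x y) = 0" if "(x, y) \<in> B" "x \<noteq> y" for x y
      using that col_cases[of x y] col_0[of x y] by (auto simp: B_def cB_def cG_def)
    show "cG (col x y) \<in> {-1, 1}" if "x \<in> {..<N}" "y \<in> {..<N}" "(x, y) \<notin> B" for x y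
      using that col_cases[of x y] by (auto simp: B_def cB_def cG_def)
    show "cG (col x y) = 1" if "(x, y) \<in> R" "(x, y) \<notin> B" for x y
      using that col_cases[of x y] by (auto simp: B_def R_def cB_def cR_def cG_def)
    show "(\<Sum>z\<in>C. cG (col x z) * cG (col z y)) = 2 * n * cG (col x y)"
      if xy: "x \<in> {..<N}" "y \<in> {..<N}" and C: "C \<in> {..<N} // B" for x y C
    proof -
      have C_sub: "C \<subseteq> {..<N}" using C B by (metis Union_quotient Union_upper)
      have card_C: "card C = 4 * n\<^sup>2" using C card_B by (auto elim: quotientE)
      have off: "cG (col u v) = 0" if "u \<in> C" "v \<in> C" "u \<noteq> v" for u v
        using that in_quotient_imp_in_rel[OF B C, of u v] by (intro in_B) auto
      have sq: "(\<Sum>z<N. cG (col u z) * cG (col z v)) =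
          real (2 * n) * real (m + 1) * cG (col u v)" if "u \<in> {..<N}" "v \<in> {..<N}" for u v
        using col_sum[OF _ _ GG, of u v] that by simp
      \<comment> \<open>Here \<open>t\<close> is 2n and \<open>q\<close> is m+1, the number of
        B-classes; the trace condition says that \<open>C\<close> has \<open>N\<close> divided by
        m+1 points.\<close>
      show ?thesis
      proof (rule gram_restrict[where X = "{..<N}" and G = "\<lambda>x y. cG (col x y)"])
        show "real (card {..<N}) = real (m + 1) * real (card C)"
          unfolding card_C by (simp add: N_def algebra_simps)
        show "cG (col u v) = cG (col v u)" if "u \<in> {..<N}" "v \<in> {..<N}" for u v
          using that by (simp add: col_sym)
      qed (fact finite_lessThan C_sub diag off sq xy)+
    qed
    show "(\<Sum>z\<in>D \<inter> C. cG (col x z)) = 0"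
      if x: "x \<in> {..<N}" and C: "C \<in> {..<N} // B" and D: "D \<in> {..<N} // R"
        and xC: "x \<notin> C" and xD: "x \<notin> D" for x C D
    proof -
      obtain u where u: "u \<in> {..<N}" "C = B `` {u}" using C by (rule quotientE)
      obtain v where v: "v \<in> {..<N}" "D = R `` {v}" using D by (rule quotientE)
      \<comment> \<open>A point \<open>y\<close> of the cell is fixed so that the cell becomes the
        set of points with colour 0 or 1 to \<open>y\<close>, whose indicator is
        \<open>cC\<close>.\<close>
      have "D \<inter> C \<noteq> {}" using cell[OF v(1) u(1)] u(2) v(2) assms(1) by auto
      then obtain y where y: "y \<in> D" "y \<in> C" by blast
      have sub: "D \<inter> C \<subseteq> {..<N}" by (auto simp: u(2) B_def)
      then have yN: "y < N" using y by auto
      have "sym B" "sym R" using B R by (auto simp: equiv_def)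
      then have sym: "(z, w) \<in> B \<Longrightarrow> (w, z) \<in> B" "(z, w) \<in> R \<Longrightarrow> (w, z) \<in> R" for z w
        by (auto dest: symD)
      have in_cell: "z \<in> D \<inter> C \<longleftrightarrow> (z, y) \<in> R \<and> (z, y) \<in> B" for z
      proof
        assume "z \<in> D \<inter> C"
        then show "(z, y) \<in> R \<and> (z, y) \<in> B"
          using in_quotient_imp_in_rel[OF B C, of z y] in_quotient_imp_in_rel[OF R D, of z y] y
          by simp
      next
        assume "(z, y) \<in> R \<and> (z, y) \<in> B"
        then show "z \<in> D \<inter> C"
          using in_quotient_imp_closed[OF B C y(2), of z] in_quotient_imp_closed[OF R D y(1), of z]
            sym[of z y] by simp
      qed
      have not_rel: "(x, z) \<notin> B \<and> (x, z) \<notin> R" if "z \<in> D \<inter> C" for z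
        using that in_quotient_imp_closed[OF B C, of z x] in_quotient_imp_closed[OF R D, of z x]
          xC xD sym[of x z] by blast
      \<comment> \<open>No point of the cell is B- or R-related to \<open>x\<close>, so only colours
        4 and 5 occur and \<open>cG\<close> agrees with \<open>cS\<close>. The sum is thus an entry
        of the product that \<open>SC\<close> shows to vanish.\<close>
      have "(\<Sum>z\<in>D \<inter> C. cG (col x z)) = (\<Sum>z<N. cS (col x z) * cC (col z y))"
      proof (intro sum.mono_neutral_cong_left ballI sub)
        fix z assume z: "z \<in> {..<N} - D \<inter> C"
        then have "\<not> ((z, y) \<in> R \<and> (z, y) \<in> B)" using in_cell by blast
        then have "cC (col z y) = 0"
          using z yN col_cases[of z y] by (auto simp: R_def B_def cC_def cR_def cB_def)
        then show "cS (col x z) * cC (col z y) = 0" by simp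
      next
        fix z assume z: "z \<in> D \<inter> C"
        then have "z < N" using sub by auto
        have "(z, y) \<in> R" "(z, y) \<in> B" using z in_cell by auto
        then have "cC (col z y) = 1"
          using \<open>z < N\<close> yN col_cases[of z y] by (auto simp: R_def B_def cC_def cR_def cB_def)
        moreover have "cG (col x z) = cS (col x z)"
          using not_rel[OF z] \<open>z < N\<close> x col_cases[of x z]
          by (auto simp: R_def B_def cG_def cS_def cR_def cB_def)
        ultimately show "cG (col x z) = cS (col x z) * cC (col z y)" by simp
      qed simp
      also have "\<dots> = 0" using x yN by (intro col_sum[of x y cS cC "\<lambda>_. 0"] SC) auto
      finally show ?thesis .
    qed
  qed simp_all
qed

end
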